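(* Let $d,n\ge1$ and for each $m=1,\dots,n$ let $\{U^{(m)}_s\}_{s=1}^{d^2}$ be a unitary error basis on $\mathbb{C}^d$. Let $V_m:\mathbb{C}^d\otimes\mathbb{C}^d\to\mathbb{C}^{d^2}$ be the unitary map with $\langle s|V_m|x,y\rangle=\frac1{\sqrt d}(U^{(m)}_s)_{x,y}$, and let $\eta=\frac1{\sqrt d}\sum_{j=0}^{d-1}|j\rangle\otimes|j\rangle\in\mathbb{C}^d\otimes\mathbb{C}^d$. Then the isometry $$i=(V_1\otimes V_2\otimes\cdots\otimes V_n)\circ\big(\mathrm{id}_{\mathbb{C}^d}\otimes\eta^{\otimes(n-1)}\otimes\mathrm{id}_{\mathbb{C}^d}\big):\ \mathbb{C}^d\otimes\mathbb{C}^d\to(\mathbb{C}^{d^2})^{\otimes n}$$ (where the $2n$ tensor factors $\mathbb{C}^d$ are grouped into consecutive pairs, the $m$-th pair being the input of $V_m$) gives an $[[n,1,n]]^{\mathcal P}_{d^2}$ code, where $\mathcal P\subset U(d^2)$ is the group of diagonal unitary matrices and $\mathbb{C}^d\otimes\mathbb{C}^d\cong\mathbb{C}^{d^2}$ is the logical qudit; that is, for every $(n,\mathcal P)$-local operator $e$ on $(\mathbb{C}^{d^2})^{\otimes n}$ the composite $i^\dagger\circ e\circ i$ is proportional to the identity.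
   Context: A unitary error basis on a finite-dimensional Hilbert space $K$ is a basis of the space of operators on $K$ consisting of unitary operators $U_s$ with $\mathrm{Tr}(U_s^\dagger U_t)=\delta_{s,t}\dim K$. For a subgroup $\mathcal E\subseteq U(D)$, an operator $e$ on $(\mathbb{C}^{D})^{\otimes n}$ is $(p,\mathcal E)$-local when $e=W_1\otimes\cdots\otimes W_n$ with all $W_i\in\mathcal E$ and at most $p-1$ of the $W_i$ different from the identity. By the Knill–Laflamme theorem, an isometry $i:(\mathbb{C}^D)^{\otimes k}\to(\mathbb{C}^D)^{\otimes n}$ gives an $[[n,k,p]]^{\mathcal E}_D$ code exactly when $i^\dagger\circ e\circ i$ is proportional to the identity (any factor allowed, including $0$) for every $(p,\mathcal E)$-local $e$; this is taken as the criterion here. *)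

theory Defs
  imports
    "Jordan_Normal_Form.Schur_Decomposition"
    "Jordan_Normal_Form.VS_Connect"
begin

text \<open>
  Operators \<open>\<complex>\<^sup>a \<rightarrow> \<complex>\<^sup>b\<close> are complex \<open>b \<times> a\<close> matrices with respect to the computational bases,
  which are indexed from 0.  The space \<open>(\<complex>\<^sup>D)\<^sup>\<otimes>\<^sup>n\<close> has dimension \<open>D ^ n\<close>, with basis ordered by the
  Kronecker convention: \<open>|x\<rangle> \<otimes> |y\<rangle>\<close> is the basis vector with index \<open>x * b + y\<close>, where \<open>b\<close> is the
  dimension of the second factor.  With this convention the tensor product is strictly associative,
  so regrouping tensor factors is the identity map.
\<close>

definition kron :: "complex mat \<Rightarrow> complex mat \<Rightarrow> complex mat" where
  "kron A B = mat (dim_row A * dim_row B) (dim_col A * dim_col B)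
     (\<lambda>(i, j). A $$ (i div dim_row B, j div dim_col B) * B $$ (i mod dim_row B, j mod dim_col B))"

definition kron_list :: "complex mat list \<Rightarrow> complex mat" where
  "kron_list As = foldr kron As (1\<^sub>m 1)"

definition ket :: "nat \<Rightarrow> nat \<Rightarrow> complex mat" where
  "ket D j = mat_of_cols D [unit_vec D j]"

definition mtrace :: "complex mat \<Rightarrow> complex" where
  "mtrace A = (\<Sum>i<dim_row A. A $$ (i, i))"

definition is_isometry :: "complex mat \<Rightarrow> bool" where
  "is_isometry A \<longleftrightarrow> mat_adjoint A * A = 1\<^sub>m (dim_col A)"

definition unitaries :: "nat \<Rightarrow> complex mat set" where
  "unitaries D = {A \<in> carrier_mat D D. mat_adjoint A * A = 1\<^sub>m D \<and> A * mat_adjoint A = 1\<^sub>m D}"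

definition unitary_group :: "nat \<Rightarrow> complex mat monoid" where
  "unitary_group D = \<lparr>carrier = unitaries D, monoid.mult = (*), one = 1\<^sub>m D\<rparr>"

definition diagonal_unitaries :: "nat \<Rightarrow> complex mat set" where
  "diagonal_unitaries D = {A \<in> unitaries D. diagonal_mat A}"

text \<open>A family indexed by \<open>s < d\<^sup>2\<close>; injectivity makes it a basis as a family, not just as a set.\<close>

definition unitary_error_basis :: "nat \<Rightarrow> (nat \<Rightarrow> complex mat) \<Rightarrow> bool" where
  "unitary_error_basis d U \<longleftrightarrow>
     (\<forall>s<d\<^sup>2. U s \<in> unitaries d) \<and>
     inj_on U {..<d\<^sup>2} \<and>
     vectorspace.basis class_ring (module_mat TYPE(complex) d d) (U ` {..<d\<^sup>2}) \<and>
     (\<forall>s<d\<^sup>2. \<forall>t<d\<^sup>2. mtrace (mat_adjoint (U s) * U t) = (if s = t then of_nat d else 0))"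

text \<open>``At most \<open>p - 1\<close>'' is written \<open>< p\<close> because subtraction on \<open>nat\<close> truncates.\<close>

definition is_local :: "nat \<Rightarrow> complex mat set \<Rightarrow> nat \<Rightarrow> nat \<Rightarrow> complex mat \<Rightarrow> bool" where
  "is_local D \<E> n p e \<longleftrightarrow>
     (\<exists>Ws. length Ws = n \<and> set Ws \<subseteq> \<E> \<and> card {m. m < n \<and> Ws ! m \<noteq> 1\<^sub>m D} < p \<and> e = kron_list Ws)"

text \<open>
  The \<open>[[n,k,p]]\<close> codes over qudits of dimension \<open>D\<close>, for errors in the subgroup \<open>\<E>\<close> of \<open>U(D)\<close>,
  by the Knill--Laflamme criterion.
\<close>

definition is_code :: "nat \<Rightarrow> complex mat set \<Rightarrow> nat \<Rightarrow> nat \<Rightarrow> nat \<Rightarrow> complex mat \<Rightarrow> bool" where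
  "is_code D \<E> n k p i \<longleftrightarrow>
     subgroup \<E> (unitary_group D) \<and>
     i \<in> carrier_mat (D ^ n) (D ^ k) \<and>
     is_isometry i \<and>
     (\<forall>e. is_local D \<E> n p e \<longrightarrow> (\<exists>c. mat_adjoint i * e * i = c \<cdot>\<^sub>m 1\<^sub>m (D ^ k)))"

definition ueb_map :: "nat \<Rightarrow> (nat \<Rightarrow> complex mat) \<Rightarrow> complex mat" where
  "ueb_map d U = mat (d\<^sup>2) (d\<^sup>2)
     (\<lambda>(s, r). 1 / complex_of_real (sqrt (real d)) * U s $$ (r div d, r mod d))"

definition max_entangled :: "nat \<Rightarrow> complex mat" where
  "max_entangled d = mat (d\<^sup>2) 1
     (\<lambda>(r, c). 1 / complex_of_real (sqrt (real d)) * (\<Sum>j<d. kron (ket d j) (ket d j) $$ (r, c)))"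

definition code_map :: "nat \<Rightarrow> nat \<Rightarrow> (nat \<Rightarrow> nat \<Rightarrow> complex mat) \<Rightarrow> complex mat" where
  "code_map d n U =
     kron_list (map (\<lambda>m. ueb_map d (U m)) [1..<Suc n]) *
     kron_list (1\<^sub>m d # replicate (n - 1) (max_entangled d) @ [1\<^sub>m d])"

lemma mat_adjoint_dim [simp]:
  "dim_row (mat_adjoint A) = dim_col A" "dim_col (mat_adjoint A) = dim_row A"
  by (simp_all add: mat_adjoint_def)

lemma kron_ket_ket:
  assumes "x < a" and "y < b"
  shows "kron (ket a x) (ket b y) = ket (a * b) (x * b + y)"
proof (rule eq_matI)
  fix i j
  assume "i < dim_row (ket (a * b) (x * b + y))" "j < dim_col (ket (a * b) (x * b + y))"
  then have i: "i < a * b" and j: "j = 0" by (simp_all add: ket_def)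
  have "0 < b" using assms by simp
  have 1: "i div b < a" using i by (simp add: less_mult_imp_div_less)
  have 2: "i mod b < b" using \<open>0 < b\<close> by simp
  have 3: "i = x * b + y \<longleftrightarrow> i div b = x \<and> i mod b = y"
    using assms by (auto simp: div_mult_mod_eq)
  show "kron (ket a x) (ket b y) $$ (i, j) = ket (a * b) (x * b + y) $$ (i, j)"
    using i j 1 2 3 by (auto simp: kron_def ket_def mat_of_cols_def unit_vec_def)
qed (simp_all add: kron_def ket_def)

lemma ueb_map_matrix_element:
  assumes "s < d\<^sup>2" and "x < d" and "y < d"
  shows "(mat_adjoint (ket (d\<^sup>2) s) * ueb_map d U * kron (ket d x) (ket d y)) $$ (0, 0)
           = 1 / complex_of_real (sqrt (real d)) * U s $$ (x, y)"
proof -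
  have r: "x * d + y < d\<^sup>2"
  proof -
    have "x * d + y < Suc x * d" using assms(3) by simp
    also have "\<dots> \<le> d * d" using assms(2) by (intro mult_le_mono1) simp
    finally show ?thesis by (simp add: power2_eq_square)
  qed
  have k: "kron (ket d x) (ket d y) = ket (d\<^sup>2) (x * d + y)"
    using kron_ket_ket[OF assms(2,3)] by (simp add: power2_eq_square)
  have a: "row (mat_adjoint (ket D s)) 0 = unit_vec D s" for D
    by (rule eq_vecI) (auto simp: mat_adjoint_def ket_def cols_def mat_of_cols_def mat_of_rows_def
        unit_vec_def)
  have "col (ket (d\<^sup>2) (x * d + y)) 0 = unit_vec (d\<^sup>2) (x * d + y)"
    by (simp add: ket_def)
  moreover have "row (mat_adjoint (ket (d\<^sup>2) s) * ueb_map d U) 0 = row (ueb_map d U) s"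
    using assms(1) a[of "d\<^sup>2"]
    by (intro eq_vecI) (simp_all add: ueb_map_def ket_def)
  ultimately have "(mat_adjoint (ket (d\<^sup>2) s) * ueb_map d U * ket (d\<^sup>2) (x * d + y)) $$ (0, 0)
      = row (ueb_map d U) s \<bullet> unit_vec (d\<^sup>2) (x * d + y)"
    by (simp add: ket_def)
  also have "\<dots> = ueb_map d U $$ (s, x * d + y)"
    using r assms(1) by (simp add: ueb_map_def)
  finally show ?thesis
    using r assms k by (simp add: ueb_map_def)
qed

end

theory Submission
  imports Defs
begin

text \<open>
  Up to a scalar, the code map has at row \<open>(s\<^sub>1, \<dots>, s\<^sub>n)\<close> and column \<open>(x, y)\<close> the \<open>(x, y)\<close> entry of
  the product of the \<open>n\<close> unitaries selected by the \<open>s\<^sub>m\<close>.  An error with fewer than \<open>n\<close> nontrivial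
  factors is the identity at some position \<open>m\<close>; there \<open>V\<^sub>m\<^sup>\<dagger> V\<^sub>m = 1\<close> cuts the chain in two.  The
  unitaries to the left and right of the cut then cancel against their adjoints one by one, and a
  diagonal error \<open>W\<close> next to them contributes only the scalar \<open>tr W / d\<^sup>2\<close>.
\<close>

section \<open>Matrix entries and Kronecker products in compound indices\<close>

lemma mat_adjoint_index [simp]:
  assumes "i < dim_col A" "j < dim_row A"
  shows "mat_adjoint A $$ (i, j) = cnj (A $$ (j, i))"
  using assms by (simp add: mat_adjoint_def mat_of_rows_index)

lemma mult_add_less:
  fixes x y a b :: nat
  assumes "x < a" "y < b"
  shows "x * b + y < a * b"
proof -
  have "x * b + y < Suc x * b" using assms(2) by simp
  also have "\<dots> \<le> a * b" using assms(1) by (intro mult_le_mono1) simp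
  finally show ?thesis .
qed

lemma mult_add_less_square:
  fixes x y d :: nat
  assumes "x < d" "y < d"
  shows "x * d + y < d\<^sup>2"
  using mult_add_less[OF assms] by (simp add: power2_eq_square)

text \<open>This lets a matrix product over a tensor product space be contracted one factor at a
  time.\<close>

lemma sum_lessThan_mult:
  fixes f :: "nat \<Rightarrow> 'a::comm_monoid_add"
  shows "(\<Sum>k<a * b. f k) = (\<Sum>i<a. \<Sum>j<b. f (i * b + j))"
proof -
  have "(\<Sum>k<a * b. f k) = (\<Sum>i<a. sum f {i * b..<i * b + b})"
    by (rule sum.nat_group [symmetric])
  also have "\<dots> = (\<Sum>i<a. \<Sum>j<b. f (i * b + j))"
  proof (rule sum.cong)
    fix i
    show "sum f {i * b..<i * b + b} = (\<Sum>j<b. f (i * b + j))"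
      using sum.shift_bounds_nat_ivl[of f 0 "i * b" b]
      by (simp add: add.commute lessThan_atLeast0)
  qed simp
  finally show ?thesis .
qed

lemma mult_mat_index_sum:
  assumes "i < dim_row A" "j < dim_col B" "dim_col A = dim_row B"
  shows "(A * B) $$ (i, j) = (\<Sum>k<dim_row B. A $$ (i, k) * B $$ (k, j))"
  using assms by (simp add: scalar_prod_def lessThan_atLeast0)

lemma kron_dim [simp]:
  "dim_row (kron A B) = dim_row A * dim_row B" "dim_col (kron A B) = dim_col A * dim_col B"
  by (simp_all add: kron_def)

lemma kron_index:
  assumes "i < dim_row A" "k < dim_row B" "j < dim_col A" "l < dim_col B"
  shows "kron A B $$ (i * dim_row B + k, j * dim_col B + l) = A $$ (i, j) * B $$ (k, l)"
  using assms by (simp add: kron_def mult_add_less)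

lemma kron_one_right [simp]: "kron A (1\<^sub>m 1) = A"
  by (rule eq_matI) (auto simp: kron_def)

lemma kron_one_one: "kron (1\<^sub>m a) (1\<^sub>m b) = 1\<^sub>m (a * b)"
proof (rule eq_matI)
  fix i j assume "i < dim_row (1\<^sub>m (a * b))" "j < dim_col (1\<^sub>m (a * b))"
  then have ij: "i < a * b" "j < a * b" by simp_all
  then have "b > 0" by (cases b) auto
  have "i = j" if "i div b = j div b" "i mod b = j mod b"
    using that by (metis div_mult_mod_eq)
  with ij \<open>b > 0\<close> show "kron (1\<^sub>m a) (1\<^sub>m b) $$ (i, j) = 1\<^sub>m (a * b) $$ (i, j)"
    by (auto simp: kron_def less_mult_imp_div_less)
qed simp_all

lemma kron_list_Nil [simp]: "kron_list [] = 1\<^sub>m 1"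
  by (simp add: kron_list_def)

lemma kron_list_Cons [simp]: "kron_list (A # As) = kron A (kron_list As)"
  by (simp add: kron_list_def)

lemma kron_list_square:
  "(\<And>A. A \<in> set As \<Longrightarrow> A \<in> carrier_mat D D) \<Longrightarrow>
     kron_list As \<in> carrier_mat (D ^ length As) (D ^ length As)"
proof (induction As)
  case (Cons A As)
  then have "A \<in> carrier_mat D D" "kron_list As \<in> carrier_mat (D ^ length As) (D ^ length As)"
    by simp_all
  then show ?case by (auto intro!: carrier_matI)
qed simp

lemma kron_list_ones: "kron_list (replicate n (1\<^sub>m D)) = 1\<^sub>m (D ^ n)"
  by (induction n) (simp_all add: kron_one_one)

text \<open>Two different compound indices differ in at least one digit, and the factor at that
  digit vanishes. Iterated over a list, this makes every tensor product of diagonal errors diagonal,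
  as \<open>sandwich_eq_diag_gram\<close> requires.\<close>

lemma diagonal_kron:
  assumes "diagonal_mat A" "diagonal_mat B"
    and "A \<in> carrier_mat a a" "B \<in> carrier_mat b b"
  shows "diagonal_mat (kron A B)"
proof -
  have "kron A B $$ (i, j) = 0" if "i < a * b" "j < a * b" "i \<noteq> j" for i j
  proof -
    have "b > 0" using that by (cases b) auto
    have "i div b \<noteq> j div b \<or> i mod b \<noteq> j mod b"
      using \<open>i \<noteq> j\<close> by (metis div_mult_mod_eq)
    then show ?thesis
      using assms that \<open>b > 0\<close> by (auto simp: kron_def diagonal_mat_def less_mult_imp_div_less)
  qed
  then show ?thesis using assms by (auto simp: diagonal_mat_def)
qed

lemma diagonal_kron_list:
  "(\<And>A. A \<in> set As \<Longrightarrow> A \<in> carrier_mat D D \<and> diagonal_mat A) \<Longrightarrow> diagonal_mat (kron_list As)"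
proof (induction As)
  case Nil
  then show ?case by (simp add: diagonal_mat_def)
next
  case (Cons A As)
  then show ?case
    by (auto intro!: diagonal_kron[where a = D and b = "D ^ length As"] kron_list_square)
qed

section \<open>Entries of the maps V_m and of the entangled state\<close>

lemma ueb_map_dim [simp]:
  "dim_row (ueb_map d U) = d\<^sup>2" "dim_col (ueb_map d U) = d\<^sup>2"
  by (simp_all add: ueb_map_def)

lemma ueb_map_index:
  assumes "s < d\<^sup>2" "x < d" "y < d"
  shows "ueb_map d U $$ (s, x * d + y) = 1 / complex_of_real (sqrt (real d)) * U s $$ (x, y)"
  using assms by (simp add: ueb_map_def mult_add_less power2_eq_square)

lemma inverse_sqrt_mult_self:
  "1 / complex_of_real (sqrt (real d)) * (1 / complex_of_real (sqrt (real d))) = 1 / of_nat d"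
  by (simp flip: of_real_mult)

lemma max_entangled_dim [simp]:
  "dim_row (max_entangled d) = d\<^sup>2" "dim_col (max_entangled d) = 1"
  by (simp_all add: max_entangled_def)

lemma max_entangled_index:
  assumes "b < d" "c < d"
  shows "max_entangled d $$ (b * d + c, 0)
           = (if b = c then 1 / complex_of_real (sqrt (real d)) else 0)"
proof -
  have "kron (ket d j) (ket d j) $$ (b * d + c, 0) = (if j = b then if b = c then 1 else 0 else 0)"
    if "j < d" for j
  proof -
    have "kron (ket d j) (ket d j) $$ (b * d + c, 0) = ket d j $$ (b, 0) * ket d j $$ (c, 0)"
      using kron_index[of b "ket d j" c "ket d j" 0 0] assms by (simp add: ket_def)
    then show ?thesis using assms that by (auto simp: ket_def mat_of_cols_def unit_vec_def)
  qed
  then have "(\<Sum>j<d. kron (ket d j) (ket d j) $$ (b * d + c, 0)) = (if b = c then 1 else 0)"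
    using assms by (simp add: sum.delta)
  then show ?thesis
    using assms by (simp add: max_entangled_def mult_add_less power2_eq_square)
qed

text \<open>Contracting one half of \<open>\<eta>\<close> moves that factor from the rows to the columns.\<close>

lemma kron_max_entangled_index:
  assumes "b < d" "r < d * dim_row R" "y < dim_col R"
  shows "kron (max_entangled d) R $$ (b * (d * dim_row R) + r, y)
           = 1 / complex_of_real (sqrt (real d)) * kron (1\<^sub>m d) R $$ (r, b * dim_col R + y)"
proof -
  define q where "q = dim_row R"
  \<comment> \<open>\<open>c\<close> is the index of the second half of the entangled pair and
    \<open>t\<close> the row of \<open>R\<close>. Both sides vanish unless \<open>b = c\<close>: on
    the left because of the entangled state, on the right because of the identity.\<close>
  define c where "c = r div q"
  define t where "t = r mod q"
  have q: "q > 0" using assms(2) by (cases q) (auto simp: q_def)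
  have c: "c < d" using assms(2) by (simp add: c_def q_def less_mult_imp_div_less)
  have t: "t < q" using q by (simp add: t_def)
  have r: "r = c * q + t" by (simp add: c_def t_def)
  have "kron (max_entangled d) R $$ ((b * d + c) * q + t, 0 * dim_col R + y)
      = max_entangled d $$ (b * d + c, 0) * R $$ (t, y)"
    unfolding q_def using assms c t
    by (intro kron_index) (auto simp: q_def power2_eq_square mult_add_less)
  moreover have "kron (1\<^sub>m d) R $$ (c * q + t, b * dim_col R + y) = 1\<^sub>m d $$ (c, b) * R $$ (t, y)"
    unfolding q_def using assms c t by (intro kron_index) (auto simp: q_def)
  moreover have idx: "b * (d * dim_row R) + r = (b * d + c) * q + t"
    by (simp add: r q_def algebra_simps)
  ultimately show ?thesis
    unfolding idx using assms c max_entangled_index[OF assms(1) c] by (auto simp: r)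
qed

section \<open>The code map as a chain, built qudit by qudit\<close>

text \<open>A list of bases replaces the numbered family so that induction can remove the first
  qudit. For the empty list the left factor has one column but the right one \<open>d * d\<close>
  rows, which is why the recursion starts from a single basis.\<close>

definition chain_map :: "nat \<Rightarrow> (nat \<Rightarrow> complex mat) list \<Rightarrow> complex mat" where
  "chain_map d Us = kron_list (map (ueb_map d) Us) *
     kron_list (1\<^sub>m d # replicate (length Us - 1) (max_entangled d) @ [1\<^sub>m d])"

lemma code_map_eq_chain_map: "code_map d n U = chain_map d (map U [1..<Suc n])"
  by (simp add: code_map_def chain_map_def comp_def del: upt_Suc)

lemma kron_list_ueb_map_dim [simp]:
  "dim_row (kron_list (map (ueb_map d) Us)) = (d\<^sup>2) ^ length Us"
  "dim_col (kron_list (map (ueb_map d) Us)) = (d\<^sup>2) ^ length Us"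
  by (induction Us) simp_all

lemma kron_list_max_entangled_dim [simp]:
  "dim_row (kron_list (replicate n (max_entangled d) @ [1\<^sub>m d])) = (d\<^sup>2) ^ n * d"
  "dim_col (kron_list (replicate n (max_entangled d) @ [1\<^sub>m d])) = d"
  by (induction n) (simp_all del: One_nat_def)

lemma chain_map_dim [simp]:
  "dim_row (chain_map d Us) = (d\<^sup>2) ^ length Us" "dim_col (chain_map d Us) = d\<^sup>2"
  by (simp_all add: chain_map_def power2_eq_square)

lemma chain_map_single: "chain_map d [U] = ueb_map d U"
proof -
  have "ueb_map d U \<in> carrier_mat (d * d) (d * d)"
    by (rule carrier_matI) (simp_all add: power2_eq_square)
  from right_mult_one_mat[OF this] show ?thesis
    by (simp add: chain_map_def kron_one_one del: One_nat_def)
qed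

text \<open>The first entangled pair identifies the right leg of the first V with the left leg of
  the remaining chain, at the price of a factor \<open>1 / sqrt d\<close>. The sum over the common
  index \<open>b\<close> is a matrix product, so iteration produces the product of the selected
  unitaries.\<close>

lemma chain_map_Cons_index:
  assumes "Us \<noteq> []" "s < d\<^sup>2" "t < (d\<^sup>2) ^ length Us" "x < d" "y < d"
  shows "chain_map d (U # Us) $$ (s * (d\<^sup>2) ^ length Us + t, x * d + y)
     = 1 / complex_of_real (sqrt (real d)) *
       (\<Sum>b<d. ueb_map d U $$ (s, x * d + b) * chain_map d Us $$ (t, b * d + y))"
proof -
  obtain m where m: "length Us = Suc m" using assms(1) by (cases Us) auto
  define V where "V = kron_list (map (ueb_map d) Us)"
  \<comment> \<open>\<open>R\<close> is what both input layers share: preceded by an identity it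
    feeds \<open>chain_map d Us\<close>, and preceded by an identity and one more entangled pair it
    feeds \<open>chain_map d (U # Us)\<close>.\<close>
  define R where "R = kron_list (replicate m (max_entangled d) @ [1\<^sub>m d])"
  define q where "q = (d\<^sup>2) ^ length Us"
  define g where "g = 1 / complex_of_real (sqrt (real d))"
  have dims: "dim_row V = q" "dim_col V = q" "dim_row R = (d\<^sup>2) ^ m * d" "dim_col R = d"
    by (simp_all add: V_def R_def q_def)
  have q: "d * dim_row R = q" by (simp add: dims q_def m power2_eq_square)
  have T: "chain_map d Us = V * kron (1\<^sub>m d) R"
    by (simp add: chain_map_def V_def R_def m)
  have T': "chain_map d (U # Us) = kron (ueb_map d U) V * kron (1\<^sub>m d) (kron (max_entangled d) R)"
    by (simp add: chain_map_def V_def R_def m)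
  have d2: "d\<^sup>2 = d * d" by (simp add: power2_eq_square)
  have dimM: "dim_row (kron (max_entangled d) R) = d * q" "dim_col (kron (max_entangled d) R) = d"
    by (simp_all add: dims d2 q[symmetric])
  \<comment> \<open>The intermediate index consists of the legs \<open>a\<close>, \<open>b\<close>
    of the first qudit and the inputs \<open>r\<close> of the others. The leading identity forces
    \<open>a = x\<close>; \<open>kron_max_entangled_index\<close> turns \<open>b\<close> into the
    left column index of the remaining chain.\<close>
  have entry: "kron (ueb_map d U) V $$ (s * q + t, (a * d + b) * q + r) *
         kron (1\<^sub>m d) (kron (max_entangled d) R) $$ ((a * d + b) * q + r, x * d + y)
       = (if a = x then g * (ueb_map d U $$ (s, x * d + b) *
           (V $$ (t, r) * kron (1\<^sub>m d) R $$ (r, b * d + y))) else 0)"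
    if "a < d" "b < d" "r < q" for a b r
  proof -
    have "kron (ueb_map d U) V $$ (s * dim_row V + t, (a * d + b) * dim_col V + r)
        = ueb_map d U $$ (s, a * d + b) * V $$ (t, r)"
      using assms that by (intro kron_index) (auto simp: dims d2 mult_add_less q_def)
    moreover have "kron (1\<^sub>m d) (kron (max_entangled d) R) $$
        (a * dim_row (kron (max_entangled d) R) + (b * q + r),
         x * dim_col (kron (max_entangled d) R) + y)
        = 1\<^sub>m d $$ (a, x) * kron (max_entangled d) R $$ (b * q + r, y)"
      using assms that by (intro kron_index) (simp_all only: dimM mult_add_less index_one_mat)
    moreover have "kron (max_entangled d) R $$ (b * q + r, y) = g * kron (1\<^sub>m d) R $$ (r, b * d + y)"
      using kron_max_entangled_index[of b d r R y, unfolded q] that assms by (simp add: dims g_def)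
    \<comment> \<open>The V layer groups the factors as ((a, b), r), the input layer as (a, (b, r));
      strict associativity makes these the same number.\<close>
    moreover have "(a * d + b) * q + r = a * (d * q) + (b * q + r)"
      by (simp add: algebra_simps)
    ultimately show ?thesis
      using that assms by (simp only: dims dimM) (auto simp: algebra_simps)
  qed
  have "chain_map d (U # Us) $$ (s * q + t, x * d + y)
      = (\<Sum>k<d * d * q. kron (ueb_map d U) V $$ (s * q + t, k) *
           kron (1\<^sub>m d) (kron (max_entangled d) R) $$ (k, x * d + y))"
  proof -
    have "s * q + t < d\<^sup>2 * q" using assms by (intro mult_add_less) (simp_all add: q_def)
    moreover have "x * d + y < d * d" using assms by (intro mult_add_less)
    moreover have "dim_col (kron (ueb_map d U) V) = d * d * q"
      "dim_row (kron (1\<^sub>m d) (kron (max_entangled d) R)) = d * d * q"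
      "dim_col (kron (1\<^sub>m d) (kron (max_entangled d) R)) = d * d"
      by (simp_all only: kron_dim[of "1\<^sub>m d"] dimM) (simp_all add: dims d2)
    ultimately show ?thesis
      unfolding T' by (subst mult_mat_index_sum) (simp_all only: kron_dim ueb_map_dim dims)
  qed
  also have "\<dots> = (\<Sum>a<d. \<Sum>b<d. \<Sum>r<q. if a = x then
      g * (ueb_map d U $$ (s, x * d + b) * (V $$ (t, r) * kron (1\<^sub>m d) R $$ (r, b * d + y))) else 0)"
    unfolding sum_lessThan_mult by (intro sum.cong refl) (rule entry, auto)
  also have "\<dots> = (\<Sum>a<d. if a = x then \<Sum>b<d. \<Sum>r<q.
      g * (ueb_map d U $$ (s, x * d + b) * (V $$ (t, r) * kron (1\<^sub>m d) R $$ (r, b * d + y))) else 0)"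
    by (intro sum.cong refl) simp
  also have "\<dots> = g * (\<Sum>b<d. ueb_map d U $$ (s, x * d + b) *
      (\<Sum>r<q. V $$ (t, r) * kron (1\<^sub>m d) R $$ (r, b * d + y)))"
    using assms by (simp add: sum.delta sum_distrib_left)
  also have "\<dots> = g * (\<Sum>b<d. ueb_map d U $$ (s, x * d + b) * chain_map d Us $$ (t, b * d + y))"
  proof -
    have "(\<Sum>r<q. V $$ (t, r) * kron (1\<^sub>m d) R $$ (r, b * d + y)) = chain_map d Us $$ (t, b * d + y)"
      if "b < d" for b
      unfolding T using that assms q
      by (subst mult_mat_index_sum) (simp_all add: dims mult_add_less q_def)
    then show ?thesis by simp
  qed
  finally show ?thesis by (simp add: q_def g_def)
qed

section \<open>Entries of the Knill-Laflamme operator for diagonal errors\<close>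

text \<open>For diagonal \<open>e\<close> this is the entry of the adjoint of \<open>T\<close> times
  \<open>e\<close> times \<open>T\<close>. A single sum over rows splits along tensor factors more
  easily than the two nested sums of the matrix product.\<close>

definition diag_gram :: "complex mat \<Rightarrow> complex mat \<Rightarrow> nat \<Rightarrow> nat \<Rightarrow> complex" where
  "diag_gram T e p q = (\<Sum>s<dim_row T. e $$ (s, s) * (cnj (T $$ (s, p)) * T $$ (s, q)))"

lemma sandwich_eq_diag_gram:
  assumes "diagonal_mat e" "e \<in> carrier_mat (dim_row T) (dim_row T)"
    and "p < dim_col T" "q < dim_col T"
  shows "(mat_adjoint T * e * T) $$ (p, q) = diag_gram T e p q"
proof -
  have "(mat_adjoint T * e * T) $$ (p, q)
      = (\<Sum>s<dim_row T. (\<Sum>r<dim_row T. cnj (T $$ (r, p)) * e $$ (r, s)) * T $$ (s, q))"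
    using assms
    by (subst mult_mat_index_sum) (auto simp: mult_mat_index_sum simp del: index_mult_mat(1) intro!: sum.cong)
  also have "\<dots> = (\<Sum>s<dim_row T.
      (\<Sum>r<dim_row T. if r = s then cnj (T $$ (s, p)) * e $$ (s, s) else 0) * T $$ (s, q))"
    using assms by (intro sum.cong arg_cong2[of _ _ _ _ "(*)"] refl) (auto simp: diagonal_mat_def)
  also have "\<dots> = diag_gram T e p q"
    by (simp add: diag_gram_def sum.delta algebra_simps)
  finally show ?thesis .
qed

text \<open>Expanding the conjugated and the plain copy of the chain by
  \<open>chain_map_Cons_index\<close> gives each its own bond index, \<open>b\<close> and
  \<open>b'\<close>. Since the diagonal of the error factorises, the sums over the first qudit and
  over the rest decouple once the bonds are fixed. The two factors \<open>1 / sqrt d\<close> combine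
  to \<open>1 / d\<close>.\<close>

lemma diag_gram_chain_map_Cons:
  assumes "Us \<noteq> []" "length Ws = length Us"
    and "W \<in> carrier_mat (d\<^sup>2) (d\<^sup>2)" "\<And>A. A \<in> set Ws \<Longrightarrow> A \<in> carrier_mat (d\<^sup>2) (d\<^sup>2)"
    and "x < d" "y < d" "x' < d" "y' < d"
  shows "diag_gram (chain_map d (U # Us)) (kron_list (W # Ws)) (x * d + y) (x' * d + y')
     = 1 / of_nat d * (\<Sum>b<d. \<Sum>b'<d. diag_gram (ueb_map d U) W (x * d + b) (x' * d + b') *
          diag_gram (chain_map d Us) (kron_list Ws) (b * d + y) (b' * d + y'))"
proof -
  define q where "q = (d\<^sup>2) ^ length Us"
  define g where "g = 1 / complex_of_real (sqrt (real d))"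
  define V where "V = ueb_map d U"
  define T where "T = chain_map d Us"
  define E where "E = kron_list Ws"
  have E: "E \<in> carrier_mat q q"
    unfolding E_def q_def assms(2)[symmetric] by (rule kron_list_square) (rule assms)
  have g: "cnj g * g = 1 / of_nat d"
    using inverse_sqrt_mult_self[of d] by (simp add: g_def)
  have "diag_gram (chain_map d (U # Us)) (kron_list (W # Ws)) (x * d + y) (x' * d + y')
      = (\<Sum>s<d\<^sup>2. \<Sum>t<q. (W $$ (s, s) * E $$ (t, t)) *
          (cnj (g * (\<Sum>b<d. V $$ (s, x * d + b) * T $$ (t, b * d + y))) *
           (g * (\<Sum>b'<d. V $$ (s, x' * d + b') * T $$ (t, b' * d + y')))))"
  proof -
    have e: "kron_list (W # Ws) $$ (s * q + t, s * q + t) = W $$ (s, s) * E $$ (t, t)"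
      if "s < d\<^sup>2" "t < q" for s t
      using kron_index[of s W t E s t] that assms E by (auto simp: E_def)
    have T': "chain_map d (U # Us) $$ (s * q + t, u * d + v)
        = g * (\<Sum>b<d. V $$ (s, u * d + b) * T $$ (t, b * d + v))"
      if "s < d\<^sup>2" "t < q" "u < d" "v < d" for s t u v
      using chain_map_Cons_index[OF assms(1)] that by (simp add: q_def g_def V_def T_def)
    have "dim_row (chain_map d (U # Us)) = d\<^sup>2 * q" by (simp add: q_def)
    then show ?thesis
      using assms unfolding diag_gram_def
      by (simp only: sum_lessThan_mult)
         (intro sum.cong refl, simp only: e T' lessThan_iff)
  qed
  also have "\<dots> = (\<Sum>s<d\<^sup>2. \<Sum>t<q. \<Sum>b<d. \<Sum>b'<d. (cnj g * g) *
        ((W $$ (s, s) * (cnj (V $$ (s, x * d + b)) * V $$ (s, x' * d + b'))) *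
         (E $$ (t, t) * (cnj (T $$ (t, b * d + y)) * T $$ (t, b' * d + y')))))"
    by (simp add: sum_distrib_left sum_distrib_right algebra_simps)
  \<comment> \<open>This and the next two steps move both bond sums outside the sums over the
    physical indices \<open>s\<close> and \<open>t\<close>.\<close>
  also have "\<dots> = (\<Sum>s<d\<^sup>2. \<Sum>b<d. \<Sum>t<q. \<Sum>b'<d. (cnj g * g) *
        ((W $$ (s, s) * (cnj (V $$ (s, x * d + b)) * V $$ (s, x' * d + b'))) *
         (E $$ (t, t) * (cnj (T $$ (t, b * d + y)) * T $$ (t, b' * d + y')))))"
    by (intro sum.cong refl sum.swap)
  also have "\<dots> = (\<Sum>b<d. \<Sum>s<d\<^sup>2. \<Sum>b'<d. \<Sum>t<q. (cnj g * g) *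
        ((W $$ (s, s) * (cnj (V $$ (s, x * d + b)) * V $$ (s, x' * d + b'))) *
         (E $$ (t, t) * (cnj (T $$ (t, b * d + y)) * T $$ (t, b' * d + y')))))"
    by (subst sum.swap) (intro sum.cong refl sum.swap)
  also have "\<dots> = (\<Sum>b<d. \<Sum>b'<d. \<Sum>s<d\<^sup>2. \<Sum>t<q. (cnj g * g) *
        ((W $$ (s, s) * (cnj (V $$ (s, x * d + b)) * V $$ (s, x' * d + b'))) *
         (E $$ (t, t) * (cnj (T $$ (t, b * d + y)) * T $$ (t, b' * d + y')))))"
    by (intro sum.cong refl sum.swap)
  also have "\<dots> = (cnj g * g) * (\<Sum>b<d. \<Sum>b'<d. diag_gram V W (x * d + b) (x' * d + b') *
          diag_gram T E (b * d + y) (b' * d + y'))"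
    by (simp only: diag_gram_def V_def T_def q_def ueb_map_dim chain_map_dim)
       (simp only: sum_product, simp only: sum_distrib_left)
  finally show ?thesis by (simp add: g V_def T_def E_def)
qed

section \<open>Unitarity of V_m and contractions at a single qudit\<close>

lemma unitaries_rows:
  assumes "A \<in> unitaries D" "x < D" "x' < D"
  shows "(\<Sum>b<D. cnj (A $$ (x, b)) * A $$ (x', b)) = (if x = x' then 1 else 0)"
proof -
  have A: "A \<in> carrier_mat D D" "A * mat_adjoint A = 1\<^sub>m D"
    using assms by (auto simp: unitaries_def)
  have "(A * mat_adjoint A) $$ (x', x) = (\<Sum>b<D. cnj (A $$ (x, b)) * A $$ (x', b))"
    using A(1) assms by (subst mult_mat_index_sum) (auto simp: mult.commute intro!: sum.cong)
  then show ?thesis using A assms by auto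
qed

lemma unitaries_cols:
  assumes "A \<in> unitaries D" "x < D" "x' < D"
  shows "(\<Sum>b<D. cnj (A $$ (b, x)) * A $$ (b, x')) = (if x = x' then 1 else 0)"
proof -
  have A: "A \<in> carrier_mat D D" "mat_adjoint A * A = 1\<^sub>m D"
    using assms by (auto simp: unitaries_def)
  have "(mat_adjoint A * A) $$ (x, x') = (\<Sum>b<D. cnj (A $$ (b, x)) * A $$ (b, x'))"
    using A(1) assms by (subst mult_mat_index_sum) (auto intro!: sum.cong)
  then show ?thesis using A assms by auto
qed

text \<open>The rows of V are the flattened unitaries divided by \<open>sqrt d\<close>, so trace
  orthogonality says exactly that the rows are orthonormal. As V is square, its columns are then
  orthonormal too.\<close>

lemma ueb_map_unitary:
  assumes "d \<ge> 1" "unitary_error_basis d U"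
  shows "ueb_map d U \<in> unitaries (d\<^sup>2)"
proof -
  define V where "V = ueb_map d U"
  have V: "V \<in> carrier_mat (d\<^sup>2) (d\<^sup>2)" by (auto simp: V_def)
  then have V': "mat_adjoint V \<in> carrier_mat (d\<^sup>2) (d\<^sup>2)" by auto
  have "V * mat_adjoint V = 1\<^sub>m (d\<^sup>2)"
  proof (rule eq_matI)
    fix s t assume "s < dim_row (1\<^sub>m (d\<^sup>2))" "t < dim_col (1\<^sub>m (d\<^sup>2))"
    then have st: "s < d\<^sup>2" "t < d\<^sup>2" by simp_all
    then have Us: "U s \<in> carrier_mat d d" "U t \<in> carrier_mat d d"
      using assms by (auto simp: unitary_error_basis_def unitaries_def)
    have "(V * mat_adjoint V) $$ (s, t) = (\<Sum>k<d * d. V $$ (s, k) * cnj (V $$ (t, k)))"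
      using V st by (subst mult_mat_index_sum) (auto simp: power2_eq_square intro!: sum.cong)
    also have "\<dots> = (\<Sum>x<d. \<Sum>y<d. 1 / of_nat d * (cnj (U t $$ (x, y)) * U s $$ (x, y)))"
      unfolding sum_lessThan_mult inverse_sqrt_mult_self[symmetric] V_def
      using st by (intro sum.cong refl) (simp add: ueb_map_index)
    also have "\<dots> = 1 / of_nat d * mtrace (mat_adjoint (U t) * U s)"
    proof -
      have "mtrace (mat_adjoint (U t) * U s) = (\<Sum>y<d. \<Sum>x<d. cnj (U t $$ (x, y)) * U s $$ (x, y))"
        using Us unfolding mtrace_def
        by (intro sum.cong) (auto simp: mult_mat_index_sum simp del: index_mult_mat(1) intro!: sum.cong)
      then show ?thesis by (subst sum.swap) (simp add: sum_distrib_left)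
    qed
    also have "\<dots> = 1\<^sub>m (d\<^sup>2) $$ (s, t)"
      using assms st by (auto simp: unitary_error_basis_def)
    finally show "(V * mat_adjoint V) $$ (s, t) = 1\<^sub>m (d\<^sup>2) $$ (s, t)" .
  qed (use V in auto)
  then show ?thesis
    using mat_mult_left_right_inverse[OF V V'] V by (simp add: unitaries_def flip: V_def)
qed

text \<open>For each \<open>s\<close>, joining the right legs gives the inner product of rows
  \<open>x\<close> and \<open>x'\<close> of \<open>U s\<close>, which is the same for all
  \<open>s\<close>. Hence the diagonal error enters only through its trace; the divisor
  \<open>d\<close> comes from the two normalisations of V. The left counterpart below uses columns
  instead.\<close>

lemma sum_diag_gram_ueb_map_right:
  assumes "\<And>s. s < d\<^sup>2 \<Longrightarrow> U s \<in> unitaries d" "W \<in> carrier_mat (d\<^sup>2) (d\<^sup>2)"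
    and "x < d" "x' < d"
  shows "(\<Sum>b<d. diag_gram (ueb_map d U) W (x * d + b) (x' * d + b))
           = (if x = x' then mtrace W / of_nat d else 0)"
proof -
  have "(\<Sum>b<d. diag_gram (ueb_map d U) W (x * d + b) (x' * d + b))
      = (\<Sum>s<d\<^sup>2. \<Sum>b<d. W $$ (s, s) * (1 / of_nat d) * (cnj (U s $$ (x, b)) * U s $$ (x', b)))"
    unfolding diag_gram_def inverse_sqrt_mult_self[symmetric]
    using assms by (subst sum.swap) (auto simp: ueb_map_index intro!: sum.cong)
  also have "\<dots> = (\<Sum>s<d\<^sup>2. W $$ (s, s) * (1 / of_nat d) * (if x = x' then 1 else 0))"
    using assms by (intro sum.cong refl) (simp add: unitaries_rows flip: sum_distrib_left sum_divide_distrib)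
  finally show ?thesis using assms by (simp add: mtrace_def sum_divide_distrib)
qed

lemma sum_diag_gram_ueb_map_left:
  assumes "\<And>s. s < d\<^sup>2 \<Longrightarrow> U s \<in> unitaries d" "W \<in> carrier_mat (d\<^sup>2) (d\<^sup>2)"
    and "y < d" "y' < d"
  shows "(\<Sum>b<d. diag_gram (ueb_map d U) W (b * d + y) (b * d + y'))
           = (if y = y' then mtrace W / of_nat d else 0)"
proof -
  have "(\<Sum>b<d. diag_gram (ueb_map d U) W (b * d + y) (b * d + y'))
      = (\<Sum>s<d\<^sup>2. \<Sum>b<d. W $$ (s, s) * (1 / of_nat d) * (cnj (U s $$ (b, y)) * U s $$ (b, y')))"
    unfolding diag_gram_def inverse_sqrt_mult_self[symmetric]
    using assms by (subst sum.swap) (auto simp: ueb_map_index intro!: sum.cong)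
  also have "\<dots> = (\<Sum>s<d\<^sup>2. W $$ (s, s) * (1 / of_nat d) * (if y = y' then 1 else 0))"
    using assms by (intro sum.cong refl) (simp add: unitaries_cols flip: sum_distrib_left sum_divide_distrib)
  finally show ?thesis using assms by (simp add: mtrace_def sum_divide_distrib)
qed

text \<open>This is the cut: with a trivial error the columns of V are orthonormal, so both legs
  must agree separately between the two copies.\<close>

lemma diag_gram_ueb_map_one:
  assumes "ueb_map d U \<in> unitaries (d\<^sup>2)" "p < d\<^sup>2" "q < d\<^sup>2"
  shows "diag_gram (ueb_map d U) (1\<^sub>m (d\<^sup>2)) p q = (if p = q then 1 else 0)"
  using unitaries_cols[OF assms] by (simp add: diag_gram_def)

lemma pair_index_eq_iff:
  fixes x y x' y' d :: nat
  assumes "y < d" "y' < d"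
  shows "x * d + y = x' * d + y' \<longleftrightarrow> x = x' \<and> y = y'"
proof
  assume eq: "x * d + y = x' * d + y'"
  then have "(x * d + y) div d = (x' * d + y') div d" by simp
  then have "x = x'" using assms by simp
  with eq show "x = x' \<and> y = y'" by simp
qed simp

section \<open>Contraction of the whole chain\<close>

text \<open>This evaluates the part to the right of the cut, whose left legs are joined. Cancelling
  the first unitary against its adjoint joins the bonds \<open>b\<close> and \<open>b'\<close>,
  which is the same situation for the tail. Each qudit but the last gives \<open>tr W / d\<close>
  times the bond factor \<open>1 / d\<close>; the last has no bond after it, whence the extra factor
  \<open>d\<close>.\<close>

lemma partial_trace_diag_gram_chain_map:
  assumes "d \<ge> 1" "Us \<noteq> []" "length Ws = length Us"
    and "\<And>U s. U \<in> set Us \<Longrightarrow> s < d\<^sup>2 \<Longrightarrow> U s \<in> unitaries d"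
    and "\<And>W. W \<in> set Ws \<Longrightarrow> W \<in> carrier_mat (d\<^sup>2) (d\<^sup>2)"
    and "y < d" "y' < d"
  shows "(\<Sum>x<d. diag_gram (chain_map d Us) (kron_list Ws) (x * d + y) (x * d + y'))
           = (if y = y' then of_nat d * (\<Prod>W\<leftarrow>Ws. mtrace W / (of_nat d)\<^sup>2) else 0)"
  using assms(2-5)
proof (induction Us arbitrary: Ws rule: list_nonempty_induct)
  case (single U)
  then obtain W where Ws: "Ws = [W]" by (cases Ws) auto
  show ?case
    using sum_diag_gram_ueb_map_left[of d U W y y'] single assms(1,6,7)
    by (simp add: Ws chain_map_single power2_eq_square del: One_nat_def)
next
  case (cons U Us)
  then obtain W Ws' where Ws: "Ws = W # Ws'" and len: "length Ws' = length Us"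
    by (cases Ws) auto
  have W: "W \<in> carrier_mat (d\<^sup>2) (d\<^sup>2)" "\<And>A. A \<in> set Ws' \<Longrightarrow> A \<in> carrier_mat (d\<^sup>2) (d\<^sup>2)"
    using cons.prems Ws by auto
  have U: "\<And>s. s < d\<^sup>2 \<Longrightarrow> U s \<in> unitaries d" using cons.prems by auto
  let ?G = "diag_gram (chain_map d Us) (kron_list Ws')"
  have "(\<Sum>x<d. diag_gram (chain_map d (U # Us)) (kron_list Ws) (x * d + y) (x * d + y'))
      = (\<Sum>x<d. 1 / of_nat d * (\<Sum>b<d. \<Sum>b'<d. diag_gram (ueb_map d U) W (x * d + b) (x * d + b') *
          ?G (b * d + y) (b' * d + y')))"
    unfolding Ws using cons.hyps len W assms(6,7)
    by (intro sum.cong refl diag_gram_chain_map_Cons) auto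
  \<comment> \<open>The tail does not depend on \<open>x\<close>, so the sum over \<open>x\<close>
    acts on the first qudit alone.\<close>
  also have "\<dots> = 1 / of_nat d * (\<Sum>b<d. \<Sum>b'<d. (\<Sum>x<d. diag_gram (ueb_map d U) W (x * d + b) (x * d + b')) *
          ?G (b * d + y) (b' * d + y'))"
  proof -
    let ?f = "\<lambda>x b b'.
      diag_gram (ueb_map d U) W (x * d + b) (x * d + b') * ?G (b * d + y) (b' * d + y')"
    have "(\<Sum>x<d. \<Sum>b<d. \<Sum>b'<d. ?f x b b') = (\<Sum>b<d. \<Sum>x<d. \<Sum>b'<d. ?f x b b')"
      by (rule sum.swap)
    also have "\<dots> = (\<Sum>b<d. \<Sum>b'<d. \<Sum>x<d. ?f x b b')"
      by (intro sum.cong refl sum.swap)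
    finally show ?thesis
      by (simp only: sum_distrib_left[symmetric] sum_distrib_right)
  qed
  also have "\<dots> = 1 / of_nat d * (\<Sum>b<d. \<Sum>b'<d.
      if b = b' then mtrace W / of_nat d * ?G (b * d + y) (b * d + y') else 0)"
    using U W by (intro sum.cong refl arg_cong2[of _ _ _ _ "(*)"]) (simp add: sum_diag_gram_ueb_map_left)
  also have "\<dots> = mtrace W / (of_nat d)\<^sup>2 * (\<Sum>b<d. ?G (b * d + y) (b * d + y'))"
    by (simp add: sum.delta sum_distrib_left power2_eq_square mult.assoc)
  also have "(\<Sum>b<d. ?G (b * d + y) (b * d + y'))
      = (if y = y' then of_nat d * (\<Prod>W\<leftarrow>Ws'. mtrace W / (of_nat d)\<^sup>2) else 0)"
    using cons.prems W by (intro cons.IH len) auto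
  finally show ?case by (simp add: Ws)
qed

text \<open>The induction walks from the left to the first trivial error. There the chain is cut and
  the partial trace takes care of the rest; the unitaries passed on the way cancel from the cut back
  to the left end.\<close>

lemma diag_gram_chain_map:
  assumes "d \<ge> 1" "Us \<noteq> []" "length Ws = length Us"
    and "\<And>U s. U \<in> set Us \<Longrightarrow> s < d\<^sup>2 \<Longrightarrow> U s \<in> unitaries d"
    and "\<And>U. U \<in> set Us \<Longrightarrow> ueb_map d U \<in> unitaries (d\<^sup>2)"
    and "\<And>W. W \<in> set Ws \<Longrightarrow> W \<in> carrier_mat (d\<^sup>2) (d\<^sup>2)"
    and "1\<^sub>m (d\<^sup>2) \<in> set Ws"
    and "x < d" "y < d" "x' < d" "y' < d"
  shows "diag_gram (chain_map d Us) (kron_list Ws) (x * d + y) (x' * d + y')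
           = (if x = x' \<and> y = y' then \<Prod>W\<leftarrow>Ws. mtrace W / (of_nat d)\<^sup>2 else 0)"
  using assms(2-)
\<comment> \<open>The left indices are generalised because the bonds \<open>b\<close>,
  \<open>b'\<close> take their place in the tail; the right indices stay fixed throughout.\<close>
proof (induction Us arbitrary: Ws x x' rule: list_nonempty_induct)
  case (single U)
  then have "Ws = [1\<^sub>m (d\<^sup>2)]" by (cases Ws) auto
  moreover have "mtrace (1\<^sub>m (d\<^sup>2)) / (of_nat d)\<^sup>2 = 1"
    using assms(1) by (simp add: mtrace_def)
  ultimately show ?case
    using single assms(1)
    by (simp add: chain_map_single diag_gram_ueb_map_one mult_add_less_square
        pair_index_eq_iff del: One_nat_def)
next
  case (cons U Us)
  then obtain W Ws' where Ws: "Ws = W # Ws'" and len: "length Ws' = length Us"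
    by (cases Ws) auto
  have W: "W \<in> carrier_mat (d\<^sup>2) (d\<^sup>2)" "\<And>A. A \<in> set Ws' \<Longrightarrow> A \<in> carrier_mat (d\<^sup>2) (d\<^sup>2)"
    using cons.prems Ws by auto
  have U: "\<And>s. s < d\<^sup>2 \<Longrightarrow> U s \<in> unitaries d" "ueb_map d U \<in> unitaries (d\<^sup>2)"
    using cons.prems by auto
  let ?G = "diag_gram (chain_map d Us) (kron_list Ws')"
  let ?K = "diag_gram (ueb_map d U) W"
  let ?c = "\<Prod>W\<leftarrow>Ws'. mtrace W / (of_nat d)\<^sup>2"
  have "diag_gram (chain_map d (U # Us)) (kron_list Ws) (x * d + y) (x' * d + y')
      = 1 / of_nat d * (\<Sum>b<d. \<Sum>b'<d. ?K (x * d + b) (x' * d + b') * ?G (b * d + y) (b' * d + y'))"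
    unfolding Ws using cons.hyps len W cons.prems by (intro diag_gram_chain_map_Cons) auto
  also have "\<dots> = (if x = x' \<and> y = y' then mtrace W / (of_nat d)\<^sup>2 * ?c else 0)"
  proof (cases "W = 1\<^sub>m (d\<^sup>2)")
    \<comment> \<open>The cut gives \<open>x = x'\<close> and \<open>b = b'\<close>, which leaves
      the tail with joined left legs. The factor \<open>d\<close> of its partial trace cancels the
      bond factor \<open>1 / d\<close>, and the identity itself has normalised trace 1.\<close>
    case True
    have "(\<Sum>b<d. \<Sum>b'<d. ?K (x * d + b) (x' * d + b') * ?G (b * d + y) (b' * d + y'))
        = (\<Sum>b<d. \<Sum>b'<d. if b = b' then if x = x' then ?G (b * d + y) (b * d + y') else 0 else 0)"
      using True cons.prems U
      by (intro sum.cong refl)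
         (simp add: diag_gram_ueb_map_one mult_add_less_square pair_index_eq_iff)
    also have "\<dots> = (if x = x' then \<Sum>b<d. ?G (b * d + y) (b * d + y') else 0)"
      by (simp add: sum.delta)
    also have "(\<Sum>b<d. ?G (b * d + y) (b * d + y')) = (if y = y' then of_nat d * ?c else 0)"
      using cons.hyps cons.prems W assms(1) len by (intro partial_trace_diag_gram_chain_map) auto
    finally show ?thesis
      using assms(1) True by (simp add: mtrace_def)
  next
    \<comment> \<open>The cut lies in the tail, so the induction hypothesis yields
      \<open>b = b'\<close> and \<open>y = y'\<close>. The right legs of the first qudit are now
      joined, and its unitary cancels.\<close>
    case False
    then have "1\<^sub>m (d\<^sup>2) \<in> set Ws'" using cons.prems Ws by auto
    then have "?G (b * d + y) (b' * d + y') = (if b = b' \<and> y = y' then ?c else 0)"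
      if "b < d" "b' < d" for b b'
      using that cons.prems W len by (intro cons.IH) auto
    then have "(\<Sum>b<d. \<Sum>b'<d. ?K (x * d + b) (x' * d + b') * ?G (b * d + y) (b' * d + y'))
        = (\<Sum>b<d. \<Sum>b'<d.
          if b = b' then ?K (x * d + b) (x' * d + b) * (if y = y' then ?c else 0) else 0)"
      by (intro sum.cong refl) simp
    also have "\<dots> = (\<Sum>b<d. ?K (x * d + b) (x' * d + b)) * (if y = y' then ?c else 0)"
      by (simp add: sum.delta sum_distrib_right)
    also have "(\<Sum>b<d. ?K (x * d + b) (x' * d + b)) = (if x = x' then mtrace W / of_nat d else 0)"
      using U W cons.prems by (intro sum_diag_gram_ueb_map_right) auto
    finally show ?thesis by (simp add: power2_eq_square)
  qed
  finally show ?case by (simp add: Ws)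
qed

text \<open>Splitting each logical index into its left and right digit reduces the operator to
  \<open>diag_gram_chain_map\<close>. The Knill-Laflamme scalar is the product of the normalised
  traces of the errors.\<close>

lemma sandwich_chain_map:
  assumes "d \<ge> 1" "Us \<noteq> []" "length Ws = length Us"
    and "\<And>U. U \<in> set Us \<Longrightarrow> unitary_error_basis d U"
    and "set Ws \<subseteq> diagonal_unitaries (d\<^sup>2)" "1\<^sub>m (d\<^sup>2) \<in> set Ws"
  shows "mat_adjoint (chain_map d Us) * kron_list Ws * chain_map d Us
           = (\<Prod>W\<leftarrow>Ws. mtrace W / (of_nat d)\<^sup>2) \<cdot>\<^sub>m 1\<^sub>m (d\<^sup>2)"
proof (rule eq_matI)
  let ?c = "\<Prod>W\<leftarrow>Ws. mtrace W / (of_nat d)\<^sup>2"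
  have W: "W \<in> carrier_mat (d\<^sup>2) (d\<^sup>2) \<and> diagonal_mat W" if "W \<in> set Ws" for W
    using assms(5) that by (auto simp: diagonal_unitaries_def unitaries_def)
  have U: "U s \<in> unitaries d" if "U \<in> set Us" "s < d\<^sup>2" for U s
    using assms(4)[OF that(1)] that(2) by (simp add: unitary_error_basis_def)
  have e: "kron_list Ws \<in> carrier_mat ((d\<^sup>2) ^ length Us) ((d\<^sup>2) ^ length Us)"
    unfolding assms(3)[symmetric] using W by (intro kron_list_square) auto
  fix p q assume "p < dim_row (?c \<cdot>\<^sub>m 1\<^sub>m (d\<^sup>2))" "q < dim_col (?c \<cdot>\<^sub>m 1\<^sub>m (d\<^sup>2))"
  then have pq: "p < d\<^sup>2" "q < d\<^sup>2" by simp_all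
  then have xy: "p div d < d" "q div d < d" "p mod d < d" "q mod d < d"
    using assms(1) by (simp_all add: power2_eq_square less_mult_imp_div_less)
  have "(mat_adjoint (chain_map d Us) * kron_list Ws * chain_map d Us) $$ (p, q)
      = diag_gram (chain_map d Us) (kron_list Ws) p q"
    using e pq W by (intro sandwich_eq_diag_gram diagonal_kron_list) auto
  also have "\<dots> = diag_gram (chain_map d Us) (kron_list Ws)
      (p div d * d + p mod d) (q div d * d + q mod d)"
    by simp
  also have "\<dots> = (if p div d = q div d \<and> p mod d = q mod d then ?c else 0)"
    using assms W U xy by (intro diag_gram_chain_map) (auto intro: ueb_map_unitary)
  also have "p div d = q div d \<and> p mod d = q mod d \<longleftrightarrow> p = q"
    by (metis div_mult_mod_eq)
  finally show "(mat_adjoint (chain_map d Us) * kron_list Ws * chain_map d Us) $$ (p, q)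
      = (?c \<cdot>\<^sub>m 1\<^sub>m (d\<^sup>2)) $$ (p, q)"
    using pq by simp
qed simp_all

section \<open>The diagonal unitaries as a subgroup of the unitary group\<close>

lemma mat_adjoint_mult:
  fixes A B :: "complex mat"
  assumes "A \<in> carrier_mat a b" "B \<in> carrier_mat b c"
  shows "mat_adjoint (A * B) = mat_adjoint B * mat_adjoint A"
  using assms
  by (intro eq_matI)
     (auto simp: mult_mat_index_sum mult.commute simp del: index_mult_mat(1) intro!: sum.cong)

lemma mat_adjoint_adjoint:
  fixes A :: "complex mat"
  shows "mat_adjoint (mat_adjoint A) = A"
  by (rule eq_matI) auto

lemma mat_adjoint_one: "mat_adjoint (1\<^sub>m D) = (1\<^sub>m D :: complex mat)"
  by (rule eq_matI) auto

lemma unitaries_mult: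
  assumes "A \<in> unitaries D" "B \<in> unitaries D"
  shows "A * B \<in> unitaries D"
proof -
  have A: "A \<in> carrier_mat D D" "mat_adjoint A \<in> carrier_mat D D"
      "mat_adjoint A * A = 1\<^sub>m D" "A * mat_adjoint A = 1\<^sub>m D"
    and B: "B \<in> carrier_mat D D" "mat_adjoint B \<in> carrier_mat D D"
      "mat_adjoint B * B = 1\<^sub>m D" "B * mat_adjoint B = 1\<^sub>m D"
    using assms unfolding unitaries_def by (auto intro!: carrier_matI)
  \<comment> \<open>This regrouping brings a factor next to its adjoint, so the inner pair cancels
    first and then the outer one.\<close>
  have assoc: "X * Y * (Z * Q) = X * (Y * Z) * Q"
    if "X \<in> carrier_mat D D" "Y \<in> carrier_mat D D" "Z \<in> carrier_mat D D" "Q \<in> carrier_mat D D"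
    for X Y Z Q :: "complex mat"
    using that by (simp add: assoc_mult_mat[of _ D D _ D _ D])
  have "mat_adjoint B * mat_adjoint A * (A * B) = 1\<^sub>m D"
    using A B by (subst assoc) simp_all
  moreover have "A * B * (mat_adjoint B * mat_adjoint A) = 1\<^sub>m D"
    using A B by (subst assoc) simp_all
  ultimately show ?thesis
    using A B by (simp add: unitaries_def mat_adjoint_mult[OF A(1) B(1)])
qed

lemma unitaries_adjoint: "A \<in> unitaries D \<Longrightarrow> mat_adjoint A \<in> unitaries D"
  by (auto simp: unitaries_def mat_adjoint_adjoint)

lemma group_unitary_group: "group (unitary_group D)"
proof (rule groupI)
  fix A assume "A \<in> carrier (unitary_group D)"
  then show "\<exists>B\<in>carrier (unitary_group D). B \<otimes>\<^bsub>unitary_group D\<^esub> A = \<one>\<^bsub>unitary_group D\<^esub>"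
    by (intro bexI[of _ "mat_adjoint A"])
       (auto simp: unitary_group_def unitaries_adjoint, simp add: unitaries_def)
qed (auto simp: unitary_group_def unitaries_mult, auto simp: unitaries_def mat_adjoint_one)

lemma subgroup_diagonal_unitaries: "subgroup (diagonal_unitaries D) (unitary_group D)"
proof (rule group.subgroupI[OF group_unitary_group])
  show "diagonal_unitaries D \<subseteq> carrier (unitary_group D)"
    by (auto simp: diagonal_unitaries_def unitary_group_def)
  have "1\<^sub>m D \<in> diagonal_unitaries D"
    by (auto simp: diagonal_unitaries_def unitaries_def mat_adjoint_one diagonal_mat_def)
  then show "diagonal_unitaries D \<noteq> {}" by blast
next
  fix A assume A: "A \<in> diagonal_unitaries D"
  then have "inv\<^bsub>unitary_group D\<^esub> A = mat_adjoint A"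
    by (intro group.inv_equality[OF group_unitary_group])
       (auto simp: diagonal_unitaries_def unitary_group_def unitaries_adjoint, simp add: unitaries_def)
  moreover have "diagonal_mat (mat_adjoint A)"
    using A by (auto simp: diagonal_unitaries_def diagonal_mat_def)
  ultimately show "inv\<^bsub>unitary_group D\<^esub> A \<in> diagonal_unitaries D"
    using A by (simp add: diagonal_unitaries_def unitaries_adjoint)
next
  fix A B assume "A \<in> diagonal_unitaries D" "B \<in> diagonal_unitaries D"
  then have A: "A \<in> unitaries D" "diagonal_mat A" "A \<in> carrier_mat D D"
    and B: "B \<in> unitaries D" "diagonal_mat B" "B \<in> carrier_mat D D"
    by (auto simp: diagonal_unitaries_def unitaries_def)
  have "(A * B) $$ (i, j) = 0" if "i < D" "j < D" "i \<noteq> j" for i j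
  proof -
    have "(A * B) $$ (i, j) = (\<Sum>k<D. A $$ (i, k) * B $$ (k, j))"
      using A B that by (subst mult_mat_index_sum) auto
    also have "\<dots> = 0"
    proof (rule sum.neutral, rule ballI)
      fix k assume "k \<in> {..<D}"
      then show "A $$ (i, k) * B $$ (k, j) = 0"
        using A B that by (cases "k = i") (auto simp: diagonal_mat_def)
    qed
    finally show ?thesis .
  qed
  then have "diagonal_mat (A * B)"
    using A B by (auto simp: diagonal_mat_def simp del: index_mult_mat(1))
  then show "A \<otimes>\<^bsub>unitary_group D\<^esub> B \<in> diagonal_unitaries D"
    using A B by (simp add: diagonal_unitaries_def unitary_group_def unitaries_mult)
qed

section \<open>The code property\<close>

theorem mainTheorem9:
  fixes d n :: nat and U :: "nat \<Rightarrow> nat \<Rightarrow> complex mat"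
  assumes "d \<ge> 1" and "n \<ge> 1"
    and "\<And>m. m \<in> {1..n} \<Longrightarrow> unitary_error_basis d (U m)"
  shows "(\<forall>m\<in>{1..n}. ueb_map d (U m) \<in> unitaries (d\<^sup>2)) \<and>
         is_code (d\<^sup>2) (diagonal_unitaries (d\<^sup>2)) n 1 n (code_map d n U)"
proof -
  define T where "T = code_map d n U"
  define Us where "Us = map U [1..<Suc n]"
  have T: "T = chain_map d Us"
    by (simp add: T_def Us_def code_map_eq_chain_map)
  have Us: "Us \<noteq> []" "length Us = n" using assms(2) by (auto simp: Us_def)
  have ueb: "unitary_error_basis d V" if "V \<in> set Us" for V
    using that assms(3) by (auto simp: Us_def simp del: upt_Suc)
  have T_carrier: "T \<in> carrier_mat ((d\<^sup>2) ^ n) ((d\<^sup>2) ^ 1)"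
    by (rule carrier_matI) (simp_all add: T Us)
  have sandwich: "mat_adjoint T * kron_list Ws * T = (\<Prod>W\<leftarrow>Ws. mtrace W / (of_nat d)\<^sup>2) \<cdot>\<^sub>m 1\<^sub>m (d\<^sup>2)"
    if "length Ws = n" "set Ws \<subseteq> diagonal_unitaries (d\<^sup>2)" "1\<^sub>m (d\<^sup>2) \<in> set Ws" for Ws
    unfolding T using that ueb Us assms(1) by (intro sandwich_chain_map) auto
  have one: "1\<^sub>m (d\<^sup>2) \<in> diagonal_unitaries (d\<^sup>2)"
    by (auto simp: diagonal_unitaries_def unitaries_def mat_adjoint_one diagonal_mat_def)
  have "is_isometry T"
  proof -
    \<comment> \<open>The isometry property is the error-free instance of \<open>sandwich\<close>:
      all normalised traces are 1, and \<open>n \<ge> 1\<close> ensures that the list contains an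
      identity.\<close>
    let ?Ws = "replicate n (1\<^sub>m (d\<^sup>2)) :: complex mat list"
    have tr: "mtrace (1\<^sub>m (d\<^sup>2)) / (of_nat d)\<^sup>2 = 1"
      using assms(1) by (simp add: mtrace_def)
    have "mat_adjoint T * kron_list ?Ws * T = (\<Prod>W\<leftarrow>?Ws. mtrace W / (of_nat d)\<^sup>2) \<cdot>\<^sub>m 1\<^sub>m (d\<^sup>2)"
      using one assms(2) by (intro sandwich) auto
    also have "\<dots> = 1\<^sub>m (d\<^sup>2)"
      by (rule eq_matI) (simp_all add: tr)
    also have "mat_adjoint T * kron_list ?Ws * T = mat_adjoint T * T"
    proof -
      have "mat_adjoint T \<in> carrier_mat (d\<^sup>2) ((d\<^sup>2) ^ n)"
        using T_carrier by auto
      then show ?thesis by (simp only: kron_list_ones right_mult_one_mat)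
    qed
    finally show ?thesis using T_carrier by (simp add: is_isometry_def)
  qed
  moreover have "\<exists>c. mat_adjoint T * e * T = c \<cdot>\<^sub>m 1\<^sub>m ((d\<^sup>2) ^ 1)"
    if local: "is_local (d\<^sup>2) (diagonal_unitaries (d\<^sup>2)) n n e" for e
  proof -
    obtain Ws where Ws: "length Ws = n" "set Ws \<subseteq> diagonal_unitaries (d\<^sup>2)"
        "card {m. m < n \<and> Ws ! m \<noteq> 1\<^sub>m (d\<^sup>2)} < n" "e = kron_list Ws"
      using local unfolding is_local_def by blast
    \<comment> \<open>Fewer than \<open>n\<close> nontrivial factors among \<open>n\<close> leave at
      least one identity, which supplies the position of the cut.\<close>
    have "1\<^sub>m (d\<^sup>2) \<in> set Ws"
    proof (rule ccontr)
      assume "1\<^sub>m (d\<^sup>2) \<notin> set Ws"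
      then have "{m. m < n \<and> Ws ! m \<noteq> 1\<^sub>m (d\<^sup>2)} = {..<n}"
        using Ws(1) by (auto simp: in_set_conv_nth)
      then show False using Ws(3) by simp
    qed
    then show ?thesis using sandwich[OF Ws(1,2)] Ws(4) by auto
  qed
  ultimately have "is_code (d\<^sup>2) (diagonal_unitaries (d\<^sup>2)) n 1 n T"
    using T_carrier subgroup_diagonal_unitaries unfolding is_code_def by blast
  then show ?thesis
    using ueb_map_unitary[OF assms(1)] assms(3) by (auto simp: T_def)
qed

end
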